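(* Let $\pi\in S_n$ be a reverse-layered permutation (equivalently, $\pi$ avoids $132$ and $213$ classically). Then \[|\operatorname{SC}_{132}^{-1}(\pi)|=\sum_{k=0}^n\binom{d_\pi(k)+a_\pi(k)}{k}.\]
   Context: $S_n$ is the set of permutations of $[n]$ in one-line notation. A permutation is reverse-layered if the set of entries of each of its ascending runs (maximal consecutive increasing subsequences) is an interval of consecutive integers. To $\pi=\pi_1\cdots\pi_n$ associate the word $b_1\cdots b_n$ over $\{A,D\}$ with $b_1=A$ and, for $2\le j\le n$, $b_j=A$ if $\pi_{j-1}<\pi_j$ and $b_j=D$ if $\pi_{j-1}>\pi_j$. For $0\le k\le n$, $d_\pi(k)$ is the number of occurrences of $D$ in $b_1\cdots b_k$, and $a_\pi(k)$ is the number of occurrences of $A$ in $b_{k+1}\cdots b_n$ that appear to the right of some occurrence of $D$ in $b_{k+1}\cdots b_n$. Binomial coefficients satisfy $\binom{x}{0}=1$ and $\binom{x}{k}=0$ if $k>x\ge0$. Two sequences of distinct integers have the same relative order if replacing the $i$th smallest entry of each by $i$ yields the same word. $\operatorname{SC}_{132}:S_n\to S_n$ sends a permutation through a stack: at each step, if there is a next input entry and placing it on top of the stack would make the stack contents, read top to bottom, contain no consecutive subsequence with the same relative order as $132$, push it; otherwise pop the top entry of the stack to the end of the output; stop when the output has length $n$. *)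

theory Defs
  imports "HOL-Library.Sublist" "HOL-Combinatorics.Multiset_Permutations"
begin

text \<open>Permutations are lists in one-line notation; positions are counted from 0.\<close>

definition S :: "nat \<Rightarrow> nat list set" where
  "S n = permutations_of_set {1..n}"

definition standardize :: "nat list \<Rightarrow> nat list" where
  "standardize w = map (\<lambda>x. card {y \<in> set w. y \<le> x}) w"

definition same_relative_order :: "nat list \<Rightarrow> nat list \<Rightarrow> bool" where
  "same_relative_order u v \<longleftrightarrow> standardize u = standardize v"

definition avoids_classically :: "nat list \<Rightarrow> nat list \<Rightarrow> bool" where
  "avoids_classically p w \<longleftrightarrow> (\<nexists>u. subseq u w \<and> same_relative_order u p)"

definition avoids_consecutively :: "nat list \<Rightarrow> nat list \<Rightarrow> bool" where
  "avoids_consecutively p w \<longleftrightarrow> (\<nexists>u. sublist u w \<and> same_relative_order u p)"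

definition ascending_run :: "nat list \<Rightarrow> nat list \<Rightarrow> bool" where
  "ascending_run r w \<longleftrightarrow>
     (\<exists>us vs. w = us @ r @ vs \<and> r \<noteq> [] \<and> sorted_wrt (<) r \<and>
        (us \<noteq> [] \<longrightarrow> \<not> last us < hd r) \<and> (vs \<noteq> [] \<longrightarrow> \<not> last r < hd vs))"

definition reverse_layered :: "nat list \<Rightarrow> bool" where
  "reverse_layered w \<longleftrightarrow> (\<forall>r. ascending_run r w \<longrightarrow> (\<exists>a b. set r = {a..b}))"

datatype letter = Asc | Des

definition ad_word :: "nat list \<Rightarrow> letter list" where
  "ad_word w = map (\<lambda>j. if j = 0 \<or> w ! (j - 1) < w ! j then Asc else Des) [0..<length w]"

definition d_stat :: "nat list \<Rightarrow> nat \<Rightarrow> nat" where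
  "d_stat w k = count_list (take k (ad_word w)) Des"

definition a_stat :: "nat list \<Rightarrow> nat \<Rightarrow> nat" where
  "a_stat w k = (let b = drop k (ad_word w) in
     card {j. j < length b \<and> b ! j = Asc \<and> (\<exists>i<j. b ! i = Des)})"

text \<open>
  The arguments of \<open>sc132_run\<close> are the output so far, the stack read from top to bottom, and the
  remaining input. An entry is always pushed onto an empty stack, since a one-entry stack
  contains no pattern of length 3.
\<close>

fun sc132_run :: "nat list \<Rightarrow> nat list \<Rightarrow> nat list \<Rightarrow> nat list" where
  "sc132_run out [] [] = out"
| "sc132_run out (s # st) [] = sc132_run (out @ [s]) st []"
| "sc132_run out [] (x # inp) = sc132_run out [x] inp"
| "sc132_run out (s # st) (x # inp) =
     (if avoids_consecutively [1,3,2] (x # s # st)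
      then sc132_run out (x # s # st) inp
      else sc132_run (out @ [s]) st (x # inp))"

definition SC132 :: "nat list \<Rightarrow> nat list" where
  "SC132 w = sc132_run [] [] w"

lemma mset_sc132_run: "mset (sc132_run out st inp) = mset out + mset st + mset inp"
  by (induction out st inp rule: sc132_run.induct) auto

lemma SC132_in_S: "w \<in> S n \<Longrightarrow> SC132 w \<in> S n"
  using mset_sc132_run[of "[]" "[]" w] mset_eq_setD[of "SC132 w" w]
    mset_eq_imp_distinct_iff[of "SC132 w" w]
  by (simp add: S_def SC132_def permutations_of_set_def)

end

theory Submission
  imports Defs
begin

text \<open>
  Run the stack backwards from the output \<open>\<pi>\<close>. If the input ends when \<open>k\<close> entries have been output,
  the stack is then the suffix of \<open>\<pi>\<close> after position \<open>k\<close>, and the first \<open>k\<close> entries still have to be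
  un-popped. With \<open>x\<close> the next input entry and \<open>s\<close> the top of the stack, un-popping \<open>e\<close> is legal iff
  \<open>x < s < e\<close>. As \<open>\<pi>\<close> avoids 132 and 213, this happens exactly when the last un-push has split an
  ascent of the stack lying below \<open>e\<close>. Every such ascent can be used once; afterwards un-popping may
  go on as long as the output entries, read from right to left, increase, which is recorded by the
  descents of the output. The number of ways therefore satisfies Pascal's rule and is
  \<open>(d + a) choose k\<close>, where \<open>d\<close> counts the descents of the output and \<open>a\<close> the usable ascents.
\<close>

section \<open>Reverse-layered permutations\<close>

lemma set_subseq_subset: "subseq u v \<Longrightarrow> set u \<subseteq> set v"
  by (induction rule: list_emb.induct) auto

lemma sorted_wrt_subseq:
  assumes "subseq u v" "sorted_wrt P v"
  shows "sorted_wrt P u"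
  using assms by (induction rule: list_emb.induct) (auto dest: set_subseq_subset)

definition avoids_132_213 :: "nat list \<Rightarrow> bool" where
  "avoids_132_213 w \<longleftrightarrow>
     (\<forall>a b c. subseq [a, b, c] w \<longrightarrow> \<not> (a < c \<and> c < b) \<and> \<not> (b < a \<and> a < c))"

lemma avoids_132_213_subseq:
  assumes "avoids_132_213 w" "subseq v w"
  shows "avoids_132_213 v"
  using assms subseq_order.trans unfolding avoids_132_213_def by blast

section \<open>Order patterns of three entries\<close>

lemma standardize_less_iff:
  assumes "i < length w" "j < length w"
  shows "standardize w ! i < standardize w ! j \<longleftrightarrow> w ! i < w ! j"
proof -
  have le: "card {y \<in> set w. y \<le> w ! a} \<le> card {y \<in> set w. y \<le> w ! b}" if "w ! a \<le> w ! b" for a b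
    using that by (intro card_mono) auto
  have less: "card {y \<in> set w. y \<le> w ! a} < card {y \<in> set w. y \<le> w ! b}"
    if "w ! a < w ! b" "b < length w" for a b
  proof (rule psubset_card_mono)
    have "w ! b \<in> {y \<in> set w. y \<le> w ! b}" "w ! b \<notin> {y \<in> set w. y \<le> w ! a}"
      using that by auto
    moreover have "{y \<in> set w. y \<le> w ! a} \<subseteq> {y \<in> set w. y \<le> w ! b}"
      using that(1) by auto
    ultimately show "{y \<in> set w. y \<le> w ! a} \<subset> {y \<in> set w. y \<le> w ! b}"
      by blast
  qed simp
  show ?thesis
    using assms le[of j i] less[of i j] unfolding standardize_def
    by (cases "w ! i < w ! j") auto
qed

lemma standardize_132:
  assumes "a < c" "c < b"
  shows "standardize [a, b, c] = [1, 3, 2]"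
proof -
  have "{y \<in> set [a, b, c]. y \<le> a} = {a}" "{y \<in> set [a, b, c]. y \<le> b} = {a, b, c}"
    "{y \<in> set [a, b, c]. y \<le> c} = {a, c}"
    using assms by auto
  then show ?thesis
    using assms unfolding standardize_def list.map by simp
qed

lemma standardize_213:
  assumes "b < a" "a < c"
  shows "standardize [a, b, c] = [2, 1, 3]"
proof -
  have "{y \<in> set [a, b, c]. y \<le> a} = {a, b}" "{y \<in> set [a, b, c]. y \<le> b} = {b}"
    "{y \<in> set [a, b, c]. y \<le> c} = {a, b, c}"
    using assms by auto
  then show ?thesis
    using assms unfolding standardize_def list.map by simp
qed

text \<open>Standardization preserves the length and, by \<open>standardize_less_iff\<close>, every
  comparison of two positions, so both transfer from the pattern to \<open>u\<close>.\<close>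

lemma same_relative_order_tripleD:
  assumes "same_relative_order u [x, y, z]"
  obtains a b c where "u = [a, b, c]" "a < b \<longleftrightarrow> x < y" "b < a \<longleftrightarrow> y < x"
    "a < c \<longleftrightarrow> x < z" "c < b \<longleftrightarrow> z < y"
proof -
  have st: "standardize u = standardize [x, y, z]"
    using assms by (simp add: same_relative_order_def)
  have "length u = length (standardize u)"
    unfolding standardize_def by (rule length_map[symmetric])
  also have "\<dots> = 3"
    unfolding st by (simp add: standardize_def)
  finally have "length u = 3" .
  then obtain a b c where u: "u = [a, b, c]"
    by (auto simp: numeral_3_eq_3 length_Suc_conv)
  have iff: "[a, b, c] ! i < [a, b, c] ! j \<longleftrightarrow> [x, y, z] ! i < [x, y, z] ! j"
    if "i < 3" "j < 3" for i j
  proof -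
    have len: "i < length [a, b, c]" "j < length [a, b, c]" "i < length [x, y, z]" "j < length [x, y, z]"
      using that by simp_all
    show ?thesis
      using standardize_less_iff[OF len(1,2)] standardize_less_iff[OF len(3,4)]
      unfolding st[unfolded u] by (rule trans[OF sym])
  qed
  have "a < b \<longleftrightarrow> x < y" using iff[of 0 1] by simp
  moreover have "b < a \<longleftrightarrow> y < x" using iff[of 1 0] by simp
  moreover have "a < c \<longleftrightarrow> x < z" using iff[of 0 2] by simp
  moreover have "c < b \<longleftrightarrow> z < y" using iff[of 2 1] by simp
  ultimately show thesis
    by (rule that[OF u])
qed

lemma same_relative_order_132_iff:
  "same_relative_order u [1, 3, 2] \<longleftrightarrow> (\<exists>a b c. u = [a, b, c] \<and> a < c \<and> c < b)"
proof
  assume "same_relative_order u [1, 3, 2]"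
  then obtain a b c where "u = [a, b, c]" "a < c \<longleftrightarrow> (1::nat) < 2" "c < b \<longleftrightarrow> (2::nat) < 3"
    by (rule same_relative_order_tripleD)
  then show "\<exists>a b c. u = [a, b, c] \<and> a < c \<and> c < b"
    by simp
next
  assume "\<exists>a b c. u = [a, b, c] \<and> a < c \<and> c < b"
  then have "standardize u = [1, 3, 2]"
    using standardize_132 by blast
  moreover have "standardize [1, 3, 2] = [1, 3, 2]"
    by (rule standardize_132) simp_all
  ultimately show "same_relative_order u [1, 3, 2]"
    unfolding same_relative_order_def by (rule trans[OF _ sym])
qed

lemma same_relative_order_213_iff:
  "same_relative_order u [2, 1, 3] \<longleftrightarrow> (\<exists>a b c. u = [a, b, c] \<and> b < a \<and> a < c)"
proof
  assume "same_relative_order u [2, 1, 3]"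
  then obtain a b c where "u = [a, b, c]" "b < a \<longleftrightarrow> (1::nat) < 2" "a < c \<longleftrightarrow> (2::nat) < 3"
    by (rule same_relative_order_tripleD)
  then show "\<exists>a b c. u = [a, b, c] \<and> b < a \<and> a < c"
    by simp
next
  assume "\<exists>a b c. u = [a, b, c] \<and> b < a \<and> a < c"
  then have "standardize u = [2, 1, 3]"
    using standardize_213 by blast
  moreover have "standardize [2, 1, 3] = [2, 1, 3]"
    by (rule standardize_213) simp_all
  ultimately show "same_relative_order u [2, 1, 3]"
    unfolding same_relative_order_def by (rule trans[OF _ sym])
qed

lemma avoids_132_213_iff:
  "avoids_132_213 w \<longleftrightarrow> avoids_classically [1, 3, 2] w \<and> avoids_classically [2, 1, 3] w"
  unfolding avoids_classically_def avoids_132_213_def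
    same_relative_order_132_iff same_relative_order_213_iff
  by blast

section \<open>Reverse-layered words and ascents by one\<close>

text \<open>Local form of being reverse-layered: it speaks of adjacent entries instead of maximal
  runs, which suits induction on the word.\<close>

definition ascents_consecutive :: "nat list \<Rightarrow> bool" where
  "ascents_consecutive w \<longleftrightarrow> (\<forall>us u v vs. w = us @ u # v # vs \<and> u < v \<longrightarrow> v = Suc u)"

lemma ascents_consecutive_Cons_Cons:
  "ascents_consecutive (x # y # w) \<longleftrightarrow> (x < y \<longrightarrow> y = Suc x) \<and> ascents_consecutive (y # w)"
proof -
  have "u = x \<and> v = y \<or> (\<exists>us'. y # w = us' @ u # v # vs)"
    if "x # y # w = us @ u # v # vs" for us u v vs
    using that by (cases us) auto
  moreover have "x # y # w = (x # us) @ u # v # vs" if "y # w = us @ u # v # vs" for us u v vs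
    using that by simp
  moreover have "x # y # w = [] @ x # y # w"
    by simp
  ultimately show ?thesis
    unfolding ascents_consecutive_def by metis
qed

text \<open>Adjoining a neighbour that keeps the block increasing shortens what lies outside it, so
  the extension ends in a maximal run.\<close>

lemma ascending_run_extend:
  assumes "w = us @ r @ vs" "r \<noteq> []" "sorted_wrt (<) r"
  shows "\<exists>xs ys. ascending_run (xs @ r @ ys) w"
  using assms
proof (induction "length us + length vs" arbitrary: us r vs rule: less_induct)
  case less
  consider (left) "us \<noteq> []" "last us < hd r" | (right) "vs \<noteq> []" "last r < hd vs"
    | (maximal) "us \<noteq> [] \<longrightarrow> \<not> last us < hd r" "vs \<noteq> [] \<longrightarrow> \<not> last r < hd vs"
    by blast
  then show ?case
  proof cases
    case left
    then obtain us' u where us: "us = us' @ [u]"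
      by (cases us rule: rev_cases) auto
    have "sorted_wrt (<) (u # r)"
      using left less.prems us by (cases r) auto
    then have "\<exists>xs ys. ascending_run (xs @ (u # r) @ ys) w"
      using less.prems us by (intro less.hyps[of us' vs]) auto
    then show ?thesis
      by (metis append.assoc append_Cons append_Nil)
  next
    case right
    then obtain v vs' where vs: "vs = v # vs'"
      by (cases vs) auto
    have "sorted_wrt (<) (r @ [v])"
      using right less.prems vs
      by (cases r rule: rev_cases) (auto simp: sorted_wrt_append)
    then have "\<exists>xs ys. ascending_run (xs @ (r @ [v]) @ ys) w"
      using less.prems vs by (intro less.hyps[of us vs']) auto
    then show ?thesis
      by (metis append.assoc)
  next
    case maximal
    then have "ascending_run ([] @ r @ []) w"
      using less.prems unfolding ascending_run_def by auto
    then show ?thesis by blast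
  qed
qed

text \<open>The ascent \<open>u < v\<close> lies in some run. The run is an interval, so it contains
  \<open>Suc u\<close>; being increasing, it has nothing strictly between the neighbours
  \<open>u\<close> and \<open>v\<close>.\<close>

lemma reverse_layered_imp_ascents_consecutive:
  assumes "reverse_layered w"
  shows "ascents_consecutive w"
  unfolding ascents_consecutive_def
proof (intro allI impI)
  fix us u v vs
  assume *: "w = us @ u # v # vs \<and> u < v"
  then obtain xs ys where run: "ascending_run (xs @ [u, v] @ ys) w"
    using ascending_run_extend[of w us "[u, v]" vs] by auto
  then obtain a b where ab: "set (xs @ [u, v] @ ys) = {a..b}"
    using assms unfolding reverse_layered_def by blast
  have sorted: "sorted_wrt (<) (xs @ [u, v] @ ys)"
    using run unfolding ascending_run_def by blast
  have "u \<in> {a..b}" "v \<in> {a..b}"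
    unfolding ab[symmetric] by auto
  then have "Suc u \<in> {a..b}"
    using * by auto
  then have "Suc u \<in> set (xs @ [u, v] @ ys)"
    using ab by simp
  then show "v = Suc u"
    using sorted * by (fastforce simp: sorted_wrt_append)
qed

lemma set_consecutive_run:
  assumes "sorted_wrt (<) r" "ascents_consecutive r" "r \<noteq> []"
  shows "set r = {hd r..last r}"
  using assms
proof (induction r rule: induct_list012)
  case (3 x y zs)
  then have y: "y = Suc x"
    by (simp add: ascents_consecutive_Cons_Cons)
  have "sorted_wrt (<) (y # zs)"
    using "3.prems"(1) by simp
  moreover have "ascents_consecutive (y # zs)"
    using "3.prems"(2) unfolding ascents_consecutive_Cons_Cons by blast
  ultimately have IH: "set (y # zs) = {y..last (y # zs)}"
    using "3.IH"(2) by simp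
  have "last (y # zs) \<in> {y..last (y # zs)}"
    unfolding IH[symmetric] by (rule last_in_set) simp
  then have "y \<le> last (y # zs)"
    by (simp only: atLeastAtMost_iff)
  then have "{x..last (y # zs)} = insert x {y..last (y # zs)}"
    using y by auto
  then have "set (x # y # zs) = {x..last (y # zs)}"
    using IH by (metis list.set(2))
  then show ?case by simp
qed auto

lemma ascents_consecutive_imp_reverse_layered:
  assumes "ascents_consecutive w"
  shows "reverse_layered w"
  unfolding reverse_layered_def
proof (intro allI impI)
  fix r assume "ascending_run r w"
  then obtain us vs where w: "w = us @ r @ vs" "r \<noteq> []" "sorted_wrt (<) r"
    unfolding ascending_run_def by blast
  have "ascents_consecutive r"
    unfolding ascents_consecutive_def
  proof (intro allI impI)
    fix xs u v ys assume "r = xs @ u # v # ys \<and> u < v"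
    then have "w = (us @ xs) @ u # v # (ys @ vs) \<and> u < v"
      using w by simp
    then show "v = Suc u"
      using assms unfolding ascents_consecutive_def by blast
  qed
  then show "\<exists>a b. set r = {a..b}"
    using set_consecutive_run w by blast
qed

text \<open>An ascent prolongs the first layer of the tail by \<open>x\<close>; after a descent the
  first layer is \<open>[x]\<close> alone.\<close>

lemma first_layer:
  assumes "distinct (x # w)" "ascents_consecutive (x # w)"
  shows "\<exists>m vs. x < m \<and> x # w = [x..<m] @ vs \<and> (\<forall>v\<in>set vs. v < x)"
  using assms
proof (induction w arbitrary: x)
  case Nil
  have "x < Suc x \<and> [x] = [x..<Suc x] @ [] \<and> (\<forall>v\<in>set []. v < x)"
    by simp
  then show ?case by blast
next
  case (Cons y w)
  have "distinct (y # w)" "ascents_consecutive (y # w)"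
    using Cons.prems by (simp_all add: ascents_consecutive_Cons_Cons)
  then obtain m vs where m: "y < m" "y # w = [y..<m] @ vs" "\<forall>v\<in>set vs. v < y"
    using Cons.IH by blast
  have notin: "x \<notin> set ([y..<m] @ vs)"
    using Cons.prems(1) unfolding m(2) by simp
  show ?case
  proof (cases "x < y")
    case True
    then have y: "y = Suc x"
      using Cons.prems(2) by (simp add: ascents_consecutive_Cons_Cons)
    then have "x # y # w = [x..<m] @ vs"
      using m by (simp add: upt_conv_Cons)
    moreover have "\<forall>v\<in>set vs. v < x"
      using m(3) notin y by (metis UnCI less_Suc_eq set_append)
    ultimately show ?thesis
      using m(1) y Suc_lessD by blast
  next
    case False
    then have "x \<noteq> y" using Cons.prems by auto
    then have "y < x" using False by simp
    \<comment> \<open>The interval \<open>[y..<m]\<close> starts below \<open>x\<close> and misses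
      \<open>x\<close>, so all of it lies below \<open>x\<close>.\<close>
    then have "\<forall>v\<in>set ([y..<m] @ vs). v < x"
      using m notin by fastforce
    then have "x < Suc x \<and> x # y # w = [x..<Suc x] @ (y # w) \<and> (\<forall>v\<in>set (y # w). v < x)"
      using m(2) by simp
    then show ?thesis by blast
  qed
qed

text \<open>In both patterns the third entry exceeds the first. If the first is \<open>x\<close>,
  the third therefore lies in the first layer, and so does the second, with a value between the two.
  Patterns inside the tail are excluded by induction.\<close>

lemma ascents_consecutive_imp_avoids:
  assumes "distinct w" "ascents_consecutive w"
  shows "avoids_132_213 w"
  using assms
proof (induction w)
  case Nil
  then show ?case by (simp add: avoids_132_213_def)
next
  case (Cons x w)
  obtain m vs where m: "x < m" "x # w = [x..<m] @ vs" and vs: "\<forall>v\<in>set vs. v < x"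
    using first_layer[OF Cons.prems] by blast
  then have w: "w = [Suc x..<m] @ vs"
    by (simp add: upt_conv_Cons)
  have "ascents_consecutive w"
    using Cons.prems(2) unfolding ascents_consecutive_def by (metis append_Cons)
  then have IH: "avoids_132_213 w"
    using Cons by simp
  have layer: "x < b \<and> b < c" if bc: "subseq [b, c] w" "x < c" for b c
  proof -
    obtain l1 l2 where l: "[b, c] = l1 @ l2" "subseq l1 [Suc x..<m]" "subseq l2 vs"
      using bc(1) unfolding w subseq_append_iff by blast
    have "c \<notin> set l2"
      using set_subseq_subset[OF l(3)] vs bc(2) by force
    then have "l2 = []"
      using l(1) by (cases l2 rule: rev_cases) auto
    then have sub: "subseq [b, c] [Suc x..<m]"
      using l by simp
    then have "sorted_wrt (<) [b, c]"
      by (rule sorted_wrt_subseq) (rule sorted_wrt_upt)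
    then show ?thesis
      using set_subseq_subset[OF sub] by auto
  qed
  show ?case
    unfolding avoids_132_213_def
  proof (intro allI impI)
    fix a b c assume sub: "subseq [a, b, c] (x # w)"
    show "\<not> (a < c \<and> c < b) \<and> \<not> (b < a \<and> a < c)"
    proof (cases "a = x")
      case True
      then have "subseq [b, c] w" using sub by simp
      then show ?thesis
        using layer[of b c] True by auto
    next
      case False
      then have "subseq [a, b, c] w" using sub by simp
      then show ?thesis
        using IH unfolding avoids_132_213_def by blast
    qed
  qed
qed

text \<open>If \<open>v\<close> jumps over \<open>Suc u\<close>, this value occurs elsewhere in the
  permutation: before \<open>u\<close> it completes a 213, after \<open>v\<close> a 132.\<close>

lemma avoids_imp_ascents_consecutive:
  assumes "w \<in> S n" "avoids_132_213 w"
  shows "ascents_consecutive w"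
  unfolding ascents_consecutive_def
proof (intro allI impI)
  fix us u v vs assume w: "w = us @ u # v # vs \<and> u < v"
  have set: "set w = {1..n}"
    using assms by (auto simp: S_def permutations_of_set_def)
  show "v = Suc u"
  proof (rule ccontr)
    assume "v \<noteq> Suc u"
    then have less: "Suc u < v" using w by auto
    have "v \<in> {1..n}" unfolding set[symmetric] using w by auto
    then have "Suc u \<in> set w" unfolding set using less by auto
    then consider "Suc u \<in> set us" | "Suc u \<in> set vs"
      using w less by auto
    then show False
    proof cases
      case 1
      then have "subseq ([Suc u] @ [u, v]) (us @ u # v # vs)"
        by (intro list_emb_append_mono) (auto simp: subseq_singleton_left)
      then show False
        using assms(2) less w unfolding avoids_132_213_def by (metis append_Cons append_Nil lessI)
    next
      case 2
      then have "subseq ([] @ [u, v, Suc u]) (us @ u # v # vs)"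
        by (intro list_emb_append_mono) (auto simp: subseq_singleton_left)
      then show False
        using assms(2) less w unfolding avoids_132_213_def by (metis append_Nil lessI)
    qed
  qed
qed

lemma reverse_layered_iff_avoids:
  assumes "w \<in> S n"
  shows "reverse_layered w \<longleftrightarrow> avoids_132_213 w"
proof -
  have "distinct w"
    using assms by (auto simp: S_def permutations_of_set_def)
  then show ?thesis
    using assms reverse_layered_imp_ascents_consecutive ascents_consecutive_imp_reverse_layered
      ascents_consecutive_imp_avoids avoids_imp_ascents_consecutive by blast
qed

section \<open>The stack run backwards\<close>

lemma avoids_consecutively_132_iff:
  "avoids_consecutively [1, 3, 2] w \<longleftrightarrow> (\<forall>a b c. sublist [a, b, c] w \<longrightarrow> \<not> (a < c \<and> c < b))"
  unfolding avoids_consecutively_def same_relative_order_132_iff by blast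

lemma avoids_consecutively_132_if_avoids:
  "avoids_132_213 w \<Longrightarrow> avoids_consecutively [1, 3, 2] w"
  unfolding avoids_consecutively_132_iff avoids_132_213_def
  using sublist_imp_subseq by blast

text \<open>Since \<open>s # st\<close> contains no 132, only the three topmost entries can form
  one.\<close>

lemma avoids_consecutively_132_Cons_Cons:
  assumes "avoids_132_213 (s # st)"
  shows "avoids_consecutively [1, 3, 2] (x # s # st) \<longleftrightarrow> \<not> (\<exists>t ts. st = t # ts \<and> x < t \<and> t < s)"
proof -
  have sub: "sublist [a, b, c] (x # s # st) \<longleftrightarrow>
      a = x \<and> b = s \<and> (\<exists>ts. st = c # ts) \<or> sublist [a, b, c] (s # st)" for a b c
    unfolding sublist_Cons_right[of _ x] by (cases st) auto
  show ?thesis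
    using avoids_consecutively_132_if_avoids[OF assms]
    unfolding avoids_consecutively_132_iff sub by blast
qed

section \<open>Single steps and the inputs leading to a state\<close>

fun stack_step :: "nat list \<times> nat list \<times> nat list \<Rightarrow> nat list \<times> nat list \<times> nat list" where
  "stack_step (out, [], []) = (out, [], [])"
| "stack_step (out, s # st, []) = (out @ [s], st, [])"
| "stack_step (out, [], x # inp) = (out, [x], inp)"
| "stack_step (out, s # st, x # inp) =
     (if avoids_consecutively [1, 3, 2] (x # s # st)
      then (out, x # s # st, inp)
      else (out @ [s], st, x # inp))"

text \<open>
  Each entry is moved twice, so a state determines how many steps led to it. Hence two different
  predecessors of a state have disjoint sets of initial inputs.
\<close>

fun steps_before :: "nat list \<times> nat list \<times> nat list \<Rightarrow> nat" where
  "steps_before (out, st, inp) = 2 * length out + length st"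

fun steps_after :: "nat list \<times> nat list \<times> nat list \<Rightarrow> nat" where
  "steps_after (out, st, inp) = 2 * length inp + length st"

definition origins :: "nat list \<times> nat list \<times> nat list \<Rightarrow> nat list set" where
  "origins s = {\<sigma>. (stack_step ^^ steps_before s) ([], [], \<sigma>) = s}"

text \<open>Every push and every pop raises \<open>steps_before\<close> by one; the inequality
  covers the terminal states, which \<open>stack_step\<close> fixes.\<close>

lemma steps_before_step: "steps_before (stack_step s) \<le> Suc (steps_before s)"
  by (cases s rule: stack_step.cases) auto

lemma steps_after_step: "steps_after (stack_step s) = steps_after s - 1"
  by (cases s rule: stack_step.cases) auto

lemma steps_before_iterate: "steps_before ((stack_step ^^ t) ([], [], \<sigma>)) \<le> t"
proof (induction t)
  case (Suc t)
  then show ?case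
    using steps_before_step[of "(stack_step ^^ t) ([], [], \<sigma>)"] by simp
qed simp

lemma steps_after_iterate: "steps_after ((stack_step ^^ t) s) = steps_after s - t"
  by (induction t) (simp_all add: steps_after_step)

lemma sc132_run_iterate:
  assumes "(stack_step ^^ t) (out, st, inp) = (out', st', inp')"
  shows "sc132_run out st inp = sc132_run out' st' inp'"
  using assms
proof (induction t arbitrary: out' st' inp')
  case (Suc t)
  obtain o1 s1 i1 where 1: "(stack_step ^^ t) (out, st, inp) = (o1, s1, i1)"
    by (metis prod_cases3)
  have "stack_step (o1, s1, i1) = (out', st', inp')"
    using Suc.prems 1 by simp
  then have "sc132_run o1 s1 i1 = sc132_run out' st' inp'"
    by (cases "(o1, s1, i1)" rule: stack_step.cases) (auto split: if_splits)
  then show ?case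
    using Suc.IH[OF 1] by simp
qed simp

text \<open>After \<open>2 * length \<pi>\<close> steps both input and stack are exhausted, so the
  state reached carries the final output.\<close>

lemma SC132_eq_iff:
  assumes "length \<sigma> = length \<pi>"
  shows "SC132 \<sigma> = \<pi> \<longleftrightarrow> \<sigma> \<in> origins (\<pi>, [], [])"
proof -
  obtain out st inp where
    final: "(stack_step ^^ (2 * length \<pi>)) ([], [], \<sigma>) = (out, st, inp)"
    by (metis prod_cases3)
  have "steps_after (out, st, inp) = 0"
    unfolding final[symmetric] steps_after_iterate using assms by simp
  then have "st = []" "inp = []"
    by auto
  then show ?thesis
    using sc132_run_iterate[OF final] final by (auto simp: SC132_def origins_def)
qed

text \<open>Splits by the last step taken. The condition on \<open>steps_before\<close> discards
  \<open>s\<close> itself, which is its own image when it is terminal.\<close>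

lemma origins_predecessors:
  assumes "steps_before s > 0"
  shows "origins s = (\<Union>s' \<in> {s'. stack_step s' = s \<and> Suc (steps_before s') = steps_before s}. origins s')"
    (is "_ = ?U")
proof
  obtain t where t: "steps_before s = Suc t"
    using assms by (cases "steps_before s") auto
  show "?U \<subseteq> origins s"
    by (auto simp: origins_def t)
  show "origins s \<subseteq> ?U"
  proof
    fix \<sigma> assume \<sigma>: "\<sigma> \<in> origins s"
    define s' where "s' = (stack_step ^^ t) ([], [], \<sigma>)"
    have step: "stack_step s' = s"
      using \<sigma> by (simp add: origins_def t s'_def)
    \<comment> \<open>The first bound gives \<open>\<le>\<close>. The second gives
      \<open>\<ge>\<close>, as one step gains at most one.\<close>
    have "steps_before s' = t"
      using steps_before_iterate[of t \<sigma>] steps_before_step[of s'] step t by (simp add: s'_def)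
    then have "\<sigma> \<in> origins s'"
      by (simp add: origins_def s'_def)
    then show "\<sigma> \<in> ?U"
      by (intro UN_I[of s']) (simp_all add: step t \<open>steps_before s' = t\<close>)
  qed
qed

lemma origins_disjoint:
  assumes "steps_before s = steps_before s'" "s \<noteq> s'"
  shows "origins s \<inter> origins s' = {}"
  using assms by (auto simp: origins_def)

text \<open>The last move was a push or a pop. Any push can be undone, because \<open>st\<close>
  contains no 132. A pop of \<open>e\<close> with \<open>x\<close> waiting was forced iff
  \<open>x\<close>, \<open>e\<close>, \<open>s\<close> form a 132.\<close>

lemma predecessors_input:
  assumes "avoids_132_213 (out @ st)"
  shows "stack_step s' = (out, st, x # inp) \<longleftrightarrow>
    (\<exists>s st'. st = s # st' \<and> s' = (out, st', s # x # inp)) \<or>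
    (\<exists>out' e s st'. out = out' @ [e] \<and> st = s # st' \<and> x < s \<and> s < e \<and> s' = (out', e # st, x # inp))"
    (is "?L \<longleftrightarrow> ?push \<or> ?pop")
proof
  have pop: "avoids_132_213 (e # st)" if "out = out' @ [e]" for out' e
    using assms that by (auto intro: avoids_132_213_subseq)
  show "?push \<or> ?pop" if ?L
  proof (cases s' rule: stack_step.cases)
    case (4 out0 s0 st0 x0 inp0)
    show ?thesis
    proof (cases "avoids_consecutively [1, 3, 2] (x0 # s0 # st0)")
      case True
      then show ?thesis using 4 that by auto
    next
      case False
      then have "out = out0 @ [s0]" "st = st0" "x0 = x" "inp0 = inp"
        using 4 that by auto
      then show ?thesis
        using False pop avoids_consecutively_132_Cons_Cons[of s0 st x] 4 by blast
    qed
  qed (use that in auto)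
  show ?L if "?push \<or> ?pop"
    using that
  proof
    assume ?push
    then obtain s st' where s: "st = s # st'" "s' = (out, st', s # x # inp)" by blast
    have "avoids_132_213 st"
      using assms by (rule avoids_132_213_subseq) (simp add: list_emb_append2)
    then have "avoids_consecutively [1, 3, 2] (s # st')"
      using s avoids_consecutively_132_if_avoids by blast
    then show ?L
      using s by (cases st') auto
  next
    assume ?pop
    then obtain out' e s st' where e: "out = out' @ [e]" "st = s # st'" "x < s" "s < e"
      "s' = (out', e # st, x # inp)" by blast
    then have "\<not> avoids_consecutively [1, 3, 2] (x # e # st)"
      using avoids_consecutively_132_Cons_Cons[OF pop[OF e(1)]] by blast
    then show ?L
      using e by simp
  qed
qed

text \<open>Once the input is exhausted pops are unconditional, so any last output entry may return
  to the stack. The equation for \<open>steps_before\<close> rules out a terminal state as its own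
  predecessor.\<close>

lemma predecessors_no_input:
  assumes "avoids_132_213 (out @ st)"
  shows "stack_step s' = (out, st, []) \<and> Suc (steps_before s') = steps_before (out, st, []) \<longleftrightarrow>
    (\<exists>s st'. st = s # st' \<and> s' = (out, st', [s])) \<or>
    (\<exists>out' e. out = out' @ [e] \<and> s' = (out', e # st, []))"
    (is "?L \<longleftrightarrow> ?push \<or> ?pop")
proof
  show "?push \<or> ?pop" if ?L
    using that by (cases s' rule: stack_step.cases) (auto split: if_splits)
  show ?L if "?push \<or> ?pop"
    using that
  proof
    assume ?push
    then obtain s st' where s: "st = s # st'" "s' = (out, st', [s])" by blast
    have "avoids_132_213 st"
      using assms by (rule avoids_132_213_subseq) (simp add: list_emb_append2)
    then have "avoids_consecutively [1, 3, 2] (s # st')"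
      using s avoids_consecutively_132_if_avoids by blast
    then show ?L
      using s by (cases st') auto
  qed auto
qed

lemma origins_start: "origins ([], [], inp) = {inp}"
  by (auto simp: origins_def)

lemma origins_push:
  assumes "avoids_132_213 (out @ s # st)" "\<not> (out \<noteq> [] \<and> x < s \<and> s < last out)"
  shows "origins (out, s # st, x # inp) = origins (out, st, s # x # inp)"
proof -
  have "{s'. stack_step s' = (out, s # st, x # inp) \<and>
      Suc (steps_before s') = steps_before (out, s # st, x # inp)} = {(out, st, s # x # inp)}"
    using assms(2) unfolding predecessors_input[OF assms(1)] by auto
  then show ?thesis
    by (subst origins_predecessors) auto
qed

lemma origins_push_pop:
  assumes "avoids_132_213 (out @ e # s # st)" "x < s" "s < e"
  shows "origins (out @ [e], s # st, x # inp) =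
    origins (out @ [e], st, s # x # inp) \<union> origins (out, e # s # st, x # inp)"
proof -
  have "avoids_132_213 ((out @ [e]) @ s # st)"
    using assms(1) by simp
  note pred = predecessors_input[OF this]
  have "{s'. stack_step s' = (out @ [e], s # st, x # inp) \<and>
      Suc (steps_before s') = steps_before (out @ [e], s # st, x # inp)} =
      {(out @ [e], st, s # x # inp), (out, e # s # st, x # inp)}"
    using assms(2,3) unfolding pred by auto
  then show ?thesis
    by (subst origins_predecessors) auto
qed

text \<open>A pop with input waiting is forced by three entries, two of them on the stack, so it
  leaves the stack nonempty; so does a push.\<close>

lemma origins_stuck:
  assumes "avoids_132_213 out" "out \<noteq> []"
  shows "origins (out, [], x # inp) = {}"
proof -
  have "{s'. stack_step s' = (out, [], x # inp) \<and>
      Suc (steps_before s') = steps_before (out, [], x # inp)} = {}"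
    using predecessors_input[of out "[]"] assms by simp
  then show ?thesis
    using assms by (subst origins_predecessors) auto
qed

section \<open>Counting the initial inputs\<close>

lemma ad_word_snoc:
  "ad_word (w @ [x]) = ad_word w @ [if w = [] \<or> last w < x then Asc else Des]"
proof -
  have "map (\<lambda>j. if j = 0 \<or> (w @ [x]) ! (j - 1) < (w @ [x]) ! j then Asc else Des) [0..<length w] =
      map (\<lambda>j. if j = 0 \<or> w ! (j - 1) < w ! j then Asc else Des) [0..<length w]"
    by (rule map_cong) (auto simp: nth_append)
  moreover have "(w @ [x]) ! (length w - 1) = last w" if "w \<noteq> []"
    using that by (simp add: nth_append last_conv_nth)
  ultimately show ?thesis
    unfolding ad_word_def by (cases "w = []") simp_all
qed

definition descents :: "nat list \<Rightarrow> nat" where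
  "descents w = count_list (ad_word w) Des"

lemma descents_Nil: "descents [] = 0"
  by (simp add: descents_def ad_word_def)

lemma descents_snoc:
  "descents (w @ [x]) = descents w + (if w = [] \<or> last w < x then 0 else 1)"
  by (simp add: descents_def ad_word_snoc)

text \<open>The first letter is always \<open>Asc\<close>. This makes the binomial coefficient
  vanish once no usable ascent is left.\<close>

lemma descents_less_length: "w \<noteq> [] \<Longrightarrow> descents w < length w"
proof (induction w rule: rev_induct)
  case (snoc x w)
  then show ?case
    by (cases "w = []") (use descents_snoc[of w x] descents_Nil in auto)
qed simp

text \<open>
  For \<open>e\<close> the last output entry, \<open>low_ascents e (x # st)\<close> counts the ascents that can still be used,
  including the one formed by the next input entry \<open>x\<close> and the top of the stack.
\<close>

fun low_ascents :: "nat \<Rightarrow> nat list \<Rightarrow> nat" where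
  "low_ascents e (x # y # w) = (if x < y \<and> y < e then 1 else 0) + low_ascents e (y # w)"
| "low_ascents e w = 0"

lemma low_ascents_cong:
  "(\<And>y. y \<in> set (tl w) \<Longrightarrow> y < e \<longleftrightarrow> y < e') \<Longrightarrow> low_ascents e w = low_ascents e' w"
  by (induction e w rule: low_ascents.induct) auto

text \<open>Induction on the number of steps already made. If only the un-push is possible, the
  count is unchanged; if the un-pop is possible too, the two sets of inputs are disjoint and their
  sizes are the summands of Pascal's rule.\<close>

lemma card_origins:
  assumes "avoids_132_213 (out @ st)" "distinct (out @ st)"
  shows "finite (origins (out, st, x # inp)) \<and>
    card (origins (out, st, x # inp)) = (descents out + low_ascents (last out) (x # st)) choose length out"
  using assms
proof (induction "2 * length out + length st" arbitrary: out st x inp rule: less_induct)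
  case less
  show ?case
  proof (cases st)
    case Nil
    show ?thesis
    proof (cases "out = []")
      case True
      then show ?thesis using Nil by (simp add: origins_start)
    next
      case False
      then have "origins (out, st, x # inp) = {}"
        using less.prems(1) Nil by (simp add: origins_stuck)
      \<comment> \<open>No ascent remains and \<open>out\<close> has fewer than
        \<open>length out\<close> descents, so the binomial coefficient is 0 too.\<close>
      then show ?thesis
        using Nil descents_less_length[OF False] by (simp add: binomial_eq_0)
    qed
  next
    case (Cons s st')
    have sub: "avoids_132_213 (out @ st')"
      using less.prems(1) by (rule avoids_132_213_subseq) (auto simp: Cons subseq_append' list_emb_Cons)
    have push: "finite (origins (out, st', s # x # inp))"
      "card (origins (out, st', s # x # inp)) =
        (descents out + low_ascents (last out) (s # st')) choose length out"
      using less.hyps[of out st' s "x # inp"] sub less.prems(2) Cons by auto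
    show ?thesis
    proof (cases "out \<noteq> [] \<and> x < s \<and> s < last out")
      case False
      then have "origins (out, st, x # inp) = origins (out, st', s # x # inp)"
        using less.prems(1) unfolding Cons by (intro origins_push)
      \<comment> \<open>For empty \<open>out\<close> the value \<open>last out\<close> is
        unspecified, but the lower index is 0; otherwise the pair \<open>x\<close>, \<open>s\<close>
        contributes 0.\<close>
      moreover have "(descents out + low_ascents (last out) (x # st)) choose length out =
          (descents out + low_ascents (last out) (s # st')) choose length out"
        using False Cons by (cases "out = []") auto
      ultimately show ?thesis
        using push by simp
    next
      case True
      then obtain out' e where out: "out = out' @ [e]"
        by (cases out rule: rev_cases) auto
      have lt: "x < s" "s < e"
        using True out by auto
      have av: "avoids_132_213 (out' @ e # s # st')"
        using less.prems(1) out Cons by simp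
      have dist: "distinct (out' @ e # s # st')"
        using less.prems(2) out Cons by simp
      \<comment> \<open>A larger \<open>t\<close> would make \<open>e\<close>, \<open>s\<close>,
        \<open>t\<close> a 213.\<close>
      have below: "t < e" if "t \<in> set (s # st')" for t
      proof (rule ccontr)
        assume "\<not> t < e"
        then have t: "e < t" "t \<in> set st'"
          using that dist lt by auto
        then have "subseq ([] @ [e, s, t]) (out' @ e # s # st')"
          by (intro list_emb_append_mono) (auto simp: subseq_singleton_left)
        then show False
          using av lt t unfolding avoids_132_213_def by auto
      qed
      have pop: "finite (origins (out', e # s # st', x # inp))"
        "card (origins (out', e # s # st', x # inp)) =
          (descents out' + low_ascents (last out') (x # e # s # st')) choose length out'"
        using less.hyps[of out' "e # s # st'" x inp] av dist out Cons by auto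
      have eq: "origins (out, st, x # inp) =
          origins (out, st', s # x # inp) \<union> origins (out', e # s # st', x # inp)"
        using origins_push_pop[OF av lt] out Cons by simp
      have disj: "origins (out, st', s # x # inp) \<inter> origins (out', e # s # st', x # inp) = {}"
        by (rule origins_disjoint) (auto simp: out)
      \<comment> \<open>With \<open>f\<close> the last entry of \<open>out'\<close>: if
        \<open>e < f\<close>, the descent lost from the output is replaced by the usable ascent from
        \<open>x\<close> to \<open>e\<close>; if \<open>f < e\<close>, neither exists. For empty
        \<open>out'\<close> the lower index is 0.\<close>
      have stat: "(descents out' + low_ascents (last out') (x # e # s # st')) choose length out' =
          (descents out + low_ascents e (s # st')) choose length out'"
      proof (cases "out' = []")
        case False
        then obtain out'' f where out': "out' = out'' @ [f]"
          by (cases out' rule: rev_cases) auto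
        have f: "f \<noteq> e" using dist out' by auto
        \<comment> \<open>A \<open>t\<close> between \<open>f\<close> and \<open>e\<close> would
          make \<open>f\<close>, \<open>e\<close>, \<open>t\<close> a 132. Hence the thresholds
          \<open>f\<close> and \<open>e\<close> count the same ascents of
          \<open>s # st'\<close>.\<close>
        have below': "t < f" if t: "t \<in> set (s # st')" for t
        proof (rule ccontr)
          assume "\<not> t < f"
          then have less: "f < t" "t < e"
            using below[OF t] dist t out' by auto
          have "subseq ([] @ [f, e, t]) (out'' @ f # e # s # st')"
            using t by (intro list_emb_append_mono) (auto simp: subseq_singleton_left)
          then have "subseq [f, e, t] (out' @ e # s # st')"
            by (simp add: out')
          then show False
            using av less unfolding avoids_132_213_def by blast
        qed
        have "low_ascents f (s # st') = low_ascents e (s # st')"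
          by (rule low_ascents_cong) (use below below' in auto)
        then show ?thesis
          using f lt unfolding out out' descents_snoc[of "out'' @ [f]"] by auto
      qed simp
      have "card (origins (out, st, x # inp)) =
          ((descents out + low_ascents e (s # st')) choose length out) +
          ((descents out + low_ascents e (s # st')) choose length out')"
        unfolding eq using push pop disj stat out by (subst card_Un_disjoint) auto
      \<comment> \<open>Pascal's rule: the usable ascent from \<open>x\<close> to \<open>s\<close>
        adds 1 to the upper index, and \<open>out\<close> is one entry longer than
        \<open>out'\<close>.\<close>
      also have "\<dots> = (descents out + low_ascents (last out) (x # st)) choose length out"
        using lt out Cons by simp
      finally show ?thesis
        using eq push pop by simp
    qed
  qed
qed

section \<open>The phase with empty input\<close>

lemma origins_no_input_push:
  assumes "avoids_132_213 (s # st)"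
  shows "origins ([], s # st, []) = origins ([], st, [s])"
proof -
  have "{s'. stack_step s' = ([], s # st, []) \<and> Suc (steps_before s') = steps_before ([], s # st, [])} =
      {([], st, [s])}"
    using assms by (subst predecessors_no_input) auto
  then show ?thesis
    by (subst origins_predecessors) auto
qed

lemma origins_no_input_push_pop:
  assumes "avoids_132_213 (out @ e # s # st)"
  shows "origins (out @ [e], s # st, []) = origins (out @ [e], st, [s]) \<union> origins (out, e # s # st, [])"
proof -
  have "{s'. stack_step s' = (out @ [e], s # st, []) \<and>
      Suc (steps_before s') = steps_before (out @ [e], s # st, [])} =
      {(out @ [e], st, [s]), (out, e # s # st, [])}"
    using assms by (subst predecessors_no_input) auto
  then show ?thesis
    by (subst origins_predecessors) auto
qed

lemma origins_no_input_pop: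
  assumes "avoids_132_213 (out @ [e])"
  shows "origins (out @ [e], [], []) = origins (out, [e], [])"
proof -
  have "{s'. stack_step s' = (out @ [e], [], []) \<and>
      Suc (steps_before s') = steps_before (out @ [e], [], [])} = {(out, [e], [])}"
    using assms by (subst predecessors_no_input) auto
  then show ?thesis
    by (subst origins_predecessors) auto
qed

text \<open>Term \<open>j\<close> counts the inputs whose last entry was pushed when exactly
  \<open>j\<close> entries had been output. Going from \<open>k\<close> to \<open>Suc k\<close>, the
  un-push yields the new term and the un-pop leads back to \<open>k\<close>.\<close>

lemma card_origins_no_input:
  assumes "avoids_132_213 w" "distinct w" "w \<noteq> []" "k \<le> length w"
  shows "finite (origins (take k w, drop k w, [])) \<and>
    card (origins (take k w, drop k w, [])) =
      (\<Sum>j=0..k. (descents (take j w) + low_ascents (last (take j w)) (drop j w)) choose j)"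
  using assms(4)
proof (induction k)
  case 0
  obtain s st where w: "w = s # st"
    using assms(3) by (cases w) auto
  have "avoids_132_213 ([] @ st)"
    using assms(1) by (rule avoids_132_213_subseq) (auto simp: w)
  then have "finite (origins ([], st, [s])) \<and> card (origins ([], st, [s])) = 1"
    using card_origins[of "[]" st s "[]"] assms(2) w by simp
  then show ?case
    using assms(1) w by (simp add: origins_no_input_push)
next
  case (Suc k)
  define out e rest where "out = take k w" and "e = w ! k" and "rest = drop (Suc k) w"
  have take: "take (Suc k) w = out @ [e]" and drop: "drop k w = e # rest"
    using Suc.prems by (simp_all add: out_def e_def rest_def take_Suc_conv_app_nth Cons_nth_drop_Suc)
  have w: "w = out @ e # rest"
    using drop by (metis append_take_drop_id out_def)
  have len: "length (out @ [e]) = Suc k"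
    using Suc.prems by (simp flip: take)
  have IH: "finite (origins (out, e # rest, []))"
    "card (origins (out, e # rest, [])) =
      (\<Sum>j=0..k. (descents (take j w) + low_ascents (last (take j w)) (drop j w)) choose j)"
    using Suc drop by (simp_all add: out_def)
  have sum: "(\<Sum>j=0..Suc k. (descents (take j w) + low_ascents (last (take j w)) (drop j w)) choose j) =
      (\<Sum>j=0..k. (descents (take j w) + low_ascents (last (take j w)) (drop j w)) choose j) +
      ((descents (out @ [e]) + low_ascents (last (out @ [e])) rest) choose Suc k)"
    by (simp add: take rest_def)
  show ?case
  proof (cases rest)
    case Nil
    \<comment> \<open>With the stack empty there is nothing to un-push; accordingly the new term is
      0, as there are fewer than \<open>Suc k\<close> descents.\<close>
    have "(descents (out @ [e]) + low_ascents (last (out @ [e])) rest) choose Suc k = 0"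
      using descents_less_length[of "out @ [e]"] len Nil by (simp add: binomial_eq_0)
    moreover have "origins (out @ [e], rest, []) = origins (out, e # rest, [])"
      using origins_no_input_pop assms(1) w Nil by simp
    ultimately show ?thesis
      using IH unfolding sum rest_def[symmetric] take by simp
  next
    case (Cons s st)
    have "subseq ((out @ [e]) @ st) ((out @ [e]) @ s # st)"
      by (simp only: subseq_append') (simp add: list_emb_Cons)
    then have "avoids_132_213 ((out @ [e]) @ st)" "distinct ((out @ [e]) @ st)"
      using assms(1,2) avoids_132_213_subseq by (auto simp: w Cons)
    from card_origins[OF this, of s "[]"]
    have push: "finite (origins (out @ [e], st, [s]))"
      "card (origins (out @ [e], st, [s])) =
        (descents (out @ [e]) + low_ascents e rest) choose Suc k"
      using len by (simp_all add: Cons)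
    have "origins (out @ [e], st, [s]) \<inter> origins (out, e # rest, []) = {}"
      by (rule origins_disjoint) (auto simp: Cons)
    moreover have "origins (out @ [e], rest, []) = origins (out @ [e], st, [s]) \<union> origins (out, e # rest, [])"
      using origins_no_input_push_pop[of out e s st] assms(1) w Cons by simp
    ultimately show ?thesis
      using IH push unfolding sum rest_def[symmetric] take by (simp add: card_Un_disjoint)
  qed
qed

section \<open>The statistics of the ascent-descent word\<close>

lemma descents_take: "descents (take k w) = d_stat w k"
proof -
  have "ad_word (take k w) = take k (ad_word w)"
    by (rule nth_equalityI) (auto simp: ad_word_def)
  then show ?thesis
    by (simp add: descents_def d_stat_def)
qed

text \<open>The letters contributed by a continuation when \<open>e\<close> is the entry before it;
  this allows cutting the word at any nonempty prefix.\<close>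

fun ad_word_from :: "nat \<Rightarrow> nat list \<Rightarrow> letter list" where
  "ad_word_from e [] = []"
| "ad_word_from e (x # w) = (if e < x then Asc else Des) # ad_word_from x w"

lemma ad_word_append:
  "us \<noteq> [] \<Longrightarrow> ad_word (us @ vs) = ad_word us @ ad_word_from (last us) vs"
proof (induction vs arbitrary: us)
  case (Cons v vs)
  then show ?case
    using Cons.IH[of "us @ [v]"] by (simp add: ad_word_snoc)
qed simp

text \<open>Recursive form of the count in \<open>a_stat\<close>: leading \<open>Asc\<close> letters
  are skipped, and all those after the first \<open>Des\<close> count.\<close>

fun asc_after_des :: "letter list \<Rightarrow> nat" where
  "asc_after_des [] = 0"
| "asc_after_des (Asc # b) = asc_after_des b"
| "asc_after_des (Des # b) = count_list b Asc"

lemma asc_after_des_eq_card: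
  "asc_after_des b = card {j. j < length b \<and> b ! j = Asc \<and> (\<exists>i<j. b ! i = Des)}"
proof (induction b rule: asc_after_des.induct)
  case (2 b)
  have "j \<in> {j. j < length (Asc # b) \<and> (Asc # b) ! j = Asc \<and> (\<exists>i<j. (Asc # b) ! i = Des)} \<longleftrightarrow>
      j \<in> Suc ` {j. j < length b \<and> b ! j = Asc \<and> (\<exists>i<j. b ! i = Des)}" for j
    by (cases j) (simp_all add: image_iff Ex_less_Suc2)
  then have "{j. j < length (Asc # b) \<and> (Asc # b) ! j = Asc \<and> (\<exists>i<j. (Asc # b) ! i = Des)} =
      Suc ` {j. j < length b \<and> b ! j = Asc \<and> (\<exists>i<j. b ! i = Des)}"
    by blast
  then show ?case
    using 2 by (simp add: card_image)
next
  case (3 b)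
  have "{j. j < length (Des # b) \<and> (Des # b) ! j = Asc \<and> (\<exists>i<j. (Des # b) ! i = Des)} =
      Suc ` {j. j < length b \<and> b ! j = Asc}"
    by (auto simp: image_iff Ex_less_Suc2 less_Suc_eq_0_disj)
  moreover have "count_list b Asc = card {j. j < length b \<and> b ! j = Asc}"
    by (simp add: count_list_eq_length_filter length_filter_conv_card eq_commute)
  ultimately show ?case
    by (simp add: card_image)
qed simp

lemma low_ascents_below:
  assumes "\<forall>y\<in>set w. y < e"
  shows "low_ascents e (x # w) = count_list (ad_word_from x w) Asc"
  using assms by (induction w arbitrary: x) auto

text \<open>If \<open>e < x\<close>, avoiding 132 leaves no later entry between them, so the
  threshold \<open>e\<close> may be replaced by \<open>x\<close>, just as a leading
  \<open>Asc\<close> is skipped. If \<open>x < e\<close>, avoiding 213 puts all later entries below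
  \<open>e\<close>, so every later ascent counts, just as after a \<open>Des\<close>.\<close>

lemma low_ascents_eq:
  assumes "avoids_132_213 (e # w)" "distinct (e # w)"
  shows "low_ascents e w = asc_after_des (ad_word_from e w)"
  using assms
proof (induction w arbitrary: e)
  case (Cons x w)
  show ?case
  proof (cases "e < x")
    case True
    have "avoids_132_213 (x # w)"
      using Cons.prems(1) by (rule avoids_132_213_subseq) auto
    then have "low_ascents x w = asc_after_des (ad_word_from x w)"
      using Cons by simp
    moreover have "low_ascents e w = low_ascents x w"
    proof (rule low_ascents_cong)
      fix y assume "y \<in> set (tl w)"
      then have y: "y \<in> set w"
        by (cases w) auto
      then have "subseq [e, x, y] (e # x # w)"
        by (simp add: subseq_singleton_left)
      then have "\<not> (e < y \<and> y < x)"
        using Cons.prems(1) unfolding avoids_132_213_def by blast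
      then show "y < e \<longleftrightarrow> y < x"
        using True y Cons.prems(2) by (metis distinct.simps(2) list.set_intros(2) nat_neq_iff order_less_trans)
    qed
    moreover have "low_ascents e (x # w) = low_ascents e w"
      using True by (cases w) auto
    ultimately show ?thesis
      using True by simp
  next
    case False
    have "y < e" if "y \<in> set w" for y
    proof -
      have "subseq [e, x, y] (e # x # w)"
        using that by (simp add: subseq_singleton_left)
      then have "\<not> (x < e \<and> e < y)"
        using Cons.prems(1) unfolding avoids_132_213_def by blast
      then show ?thesis
        using False that Cons.prems(2) by (auto simp: not_less le_less)
    qed
    then show ?thesis
      using False by (simp add: low_ascents_below)
  qed
qed simp

lemma low_ascents_drop:
  assumes "avoids_132_213 w" "distinct w" "0 < k" "k \<le> length w"
  shows "low_ascents (last (take k w)) (drop k w) = a_stat w k"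
proof -
  define us e vs where "us = butlast (take k w)" and "e = last (take k w)" and "vs = drop k w"
  have take: "take k w = us @ [e]"
    unfolding us_def e_def using assms by (intro append_butlast_last_id[symmetric]) auto
  then have w: "w = us @ e # vs"
    unfolding vs_def by (metis append_take_drop_id append.assoc append_Cons append_Nil)
  have len: "length (us @ [e]) = k"
    using assms(4) by (simp flip: take)
  have "length (ad_word (us @ [e])) = k"
    using len by (simp add: ad_word_def)
  moreover have "ad_word w = ad_word (us @ [e]) @ ad_word_from e vs"
    using ad_word_append[of "us @ [e]" vs] w by simp
  ultimately have "drop k (ad_word w) = ad_word_from e vs"
    by simp
  then have "a_stat w k = asc_after_des (ad_word_from e vs)"
    by (simp add: a_stat_def asc_after_des_eq_card Let_def)
  moreover have "avoids_132_213 (e # vs)"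
    using assms(1) by (rule avoids_132_213_subseq) (simp add: w list_emb_append2)
  then have "low_ascents e vs = asc_after_des (ad_word_from e vs)"
    using assms(2) w by (intro low_ascents_eq) auto
  ultimately show ?thesis
    by (simp add: e_def vs_def)
qed

section \<open>The number of preimages\<close>

lemma card_SC132_preimage:
  assumes "\<pi> \<in> S n" "avoids_132_213 \<pi>"
  shows "card {\<sigma> \<in> S n. SC132 \<sigma> = \<pi>} = (\<Sum>k=0..n. (d_stat \<pi> k + a_stat \<pi> k) choose k)"
proof -
  have set: "set \<pi> = {1..n}" and dist: "distinct \<pi>"
    using assms by (auto simp: S_def permutations_of_set_def)
  have S: "\<sigma> \<in> S n \<longleftrightarrow> mset \<sigma> = mset \<pi>" for \<sigma>
    using dist set_eq_iff_mset_eq_distinct[of \<sigma> \<pi>] mset_eq_setD[of \<sigma> \<pi>]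
      mset_eq_imp_distinct_iff[of \<sigma> \<pi>]
    unfolding S_def permutations_of_set_def set[symmetric] by blast
  have len: "length \<pi> = n"
    using distinct_card[OF dist] set by simp
  have "{\<sigma> \<in> S n. SC132 \<sigma> = \<pi>} = origins (\<pi>, [], [])"
  proof (intro set_eqI iffI)
    show "\<sigma> \<in> origins (\<pi>, [], [])" if "\<sigma> \<in> {\<sigma> \<in> S n. SC132 \<sigma> = \<pi>}" for \<sigma>
      using that SC132_eq_iff[of \<sigma> \<pi>] S mset_eq_length by auto
    show "\<sigma> \<in> {\<sigma> \<in> S n. SC132 \<sigma> = \<pi>}" if "\<sigma> \<in> origins (\<pi>, [], [])" for \<sigma>
    proof -
      have "(stack_step ^^ (2 * length \<pi>)) ([], [], \<sigma>) = (\<pi>, [], [])"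
        using that by (simp add: origins_def)
      then have "SC132 \<sigma> = \<pi>"
        using sc132_run_iterate by (force simp: SC132_def)
      \<comment> \<open>A run preserves the multiset of entries, so \<open>\<sigma>\<close> is a
        rearrangement of \<open>\<pi>\<close>.\<close>
      then show ?thesis
        using mset_sc132_run[of "[]" "[]" \<sigma>] S by (auto simp: SC132_def)
    qed
  qed
  moreover have "card (origins (\<pi>, [], [])) = (\<Sum>k=0..n. (d_stat \<pi> k + a_stat \<pi> k) choose k)"
  proof (cases "\<pi> = []")
    case True
    then show ?thesis
      using len by (simp add: origins_start)
  next
    case False
    have "card (origins (\<pi>, [], [])) =
        (\<Sum>k=0..n. (descents (take k \<pi>) + low_ascents (last (take k \<pi>)) (drop k \<pi>)) choose k)"
      using card_origins_no_input[OF assms(2) dist False, of n] len by simp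
    also have "\<dots> = (\<Sum>k=0..n. (d_stat \<pi> k + a_stat \<pi> k) choose k)"
    proof (rule sum.cong[OF refl])
      fix k assume "k \<in> {0..n}"
      \<comment> \<open>At \<open>k = 0\<close> the last entry of the prefix is unspecified, but
        both binomial coefficients have lower index 0.\<close>
      then show "(descents (take k \<pi>) + low_ascents (last (take k \<pi>)) (drop k \<pi>)) choose k =
          (d_stat \<pi> k + a_stat \<pi> k) choose k"
        using low_ascents_drop[OF assms(2) dist, of k] len by (cases "k = 0") (auto simp: descents_take)
    qed
    finally show ?thesis .
  qed
  ultimately show ?thesis by simp
qed

theorem theorem4p7:
  fixes n :: nat and \<pi> :: "nat list"
  assumes "\<pi> \<in> S n"
  shows "(reverse_layered \<pi> \<longleftrightarrow>
            avoids_classically [1,3,2] \<pi> \<and> avoids_classically [2,1,3] \<pi>) \<and>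
         (reverse_layered \<pi> \<longrightarrow>
            card {\<sigma> \<in> S n. SC132 \<sigma> = \<pi>} = (\<Sum>k=0..n. (d_stat \<pi> k + a_stat \<pi> k) choose k))"
  using reverse_layered_iff_avoids[OF assms] card_SC132_preimage[OF assms] avoids_132_213_iff
  by blast

end
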